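(* For every context $\Gamma$ and type $A$ of $\mathsf{TT}$ syntax $\mathbf 0_{\mathsf{TT}}$, the forgetful interpretation $\lfloor-\rfloor$ induces a map $\mathbf 0_{\mathsf{TT}_0}.\mathsf{Tm}_0\,\langle\Gamma\rangle\,\langle A\rangle \to \mathbf 0_{\mathsf{TT}}.\mathsf{Tm}\,\Gamma\,A$ which is natural in $\Gamma$ and surjective.
   Context: $\mathsf{TT}_0$ (type theory with erasure) has as syntax $\mathbf{0}_{\mathsf{TT}_0}$ the initial model of the following generalised algebraic theory: a category of contexts with empty context $\bullet$ and substitutions; presheaves of types $\mathsf{Ty}_\ell\,\Gamma$ ($\ell\in\mathbb N$), of terms $\mathsf{Tm}_i\,\Gamma\,A$ for each mode $i\in\{0,\omega\}$ ($0$ = erased, $\omega$ = runtime), and a proposition-valued presheaf $\#\in\Gamma$ (erasure marker); context extensions $\Gamma\rhd_iA$ and $\Gamma\rhd\#$ representing $\mathsf{Tm}_i$ and $\#$; a natural isomorphism $(\downarrow,\uparrow):\mathsf{Tm}_\omega\,(\Gamma\rhd\#)\,A\cong\mathsf{Tm}_0\,\Gamma\,A$; type formers $\Pi_i A B$, $\Sigma_i A B$ (with $B$ over $\Gamma\rhd_iA$) whose introduction/elimination isomorphisms are stated for runtime terms, e.g. $\mathsf{Tm}_\omega(\Gamma\rhd_iA)B\cong\mathsf{Tm}_\omega\,\Gamma\,(\Pi_iAB)$; and universes $\mathsf U_\ell$ with $\mathsf{Tm}_0\,\Gamma\,\mathsf U_\ell\cong\mathsf{Ty}_\ell\,\Gamma$.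 Erased versions of all term formers are derivable via the coercions. $\mathsf{TT}$ is ordinary Martin-Löf type theory with the same type formers (no modes, no marker), presented as the initial category with families $\mathbf 0_{\mathsf{TT}}$ with $\Pi$, $\Sigma$ and universes $\mathsf{Tm}\,\Gamma\,\mathsf U_\ell\cong\mathsf{Ty}_\ell\,\Gamma$. $\lfloor-\rfloor:\mathsf{TT}_0\to\mathsf{TT}$ is the interpretation that forgets modes and the marker: $\mathsf{Ty}_\ell\mapsto\mathsf{Ty}_\ell$, both $\mathsf{Tm}_0\,A$ and $\mathsf{Tm}_\omega\,A$ to $\mathsf{Tm}\,A$, $\#$ to the unit type, $\Pi_i,\Sigma_i$ to $\Pi,\Sigma$, coercions to identities. $\langle-\rangle:\mathsf{TT}\to\mathsf{TT}_0$ is the interpretation using the erased fragment of $\mathsf{TT}_0$: types to types, $\mathsf{Tm}\,A$ to $\mathsf{Tm}_0\,A$, context extension $\Gamma\rhd A$ to $\langle\Gamma\rangle\rhd_0\langle A\rangle$, and type/term formers to corresponding (erased-fragment) $\mathsf{TT}_0$ formers; it satisfies $\lfloor\langle-\rangle\rfloor=\mathrm{id}$. *)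

theory Defs
  imports Main
begin

text \<open>De Bruijn indices; contexts are lists with the innermost entry at the head.\<close>

datatype ty = TyU nat | TyPi ty ty | TySg ty ty | TyEl tm
     and tm = TmVar nat | TmLam ty tm | TmApp tm tm | TmPair ty tm tm
            | TmFst tm | TmSnd tm | TmCode ty

definition liftR :: "(nat \<Rightarrow> nat) \<Rightarrow> nat \<Rightarrow> nat" where
  "liftR \<rho> i = (case i of 0 \<Rightarrow> 0 | Suc j \<Rightarrow> Suc (\<rho> j))"

primrec renTy :: "(nat \<Rightarrow> nat) \<Rightarrow> ty \<Rightarrow> ty"
    and renTm :: "(nat \<Rightarrow> nat) \<Rightarrow> tm \<Rightarrow> tm" where
  "renTy \<rho> (TyU l) = TyU l"
| "renTy \<rho> (TyPi A B) = TyPi (renTy \<rho> A) (renTy (liftR \<rho>) B)"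
| "renTy \<rho> (TySg A B) = TySg (renTy \<rho> A) (renTy (liftR \<rho>) B)"
| "renTy \<rho> (TyEl t) = TyEl (renTm \<rho> t)"
| "renTm \<rho> (TmVar i) = TmVar (\<rho> i)"
| "renTm \<rho> (TmLam A t) = TmLam (renTy \<rho> A) (renTm (liftR \<rho>) t)"
| "renTm \<rho> (TmApp f a) = TmApp (renTm \<rho> f) (renTm \<rho> a)"
| "renTm \<rho> (TmPair B a b) = TmPair (renTy (liftR \<rho>) B) (renTm \<rho> a) (renTm \<rho> b)"
| "renTm \<rho> (TmFst p) = TmFst (renTm \<rho> p)"
| "renTm \<rho> (TmSnd p) = TmSnd (renTm \<rho> p)"
| "renTm \<rho> (TmCode A) = TmCode (renTy \<rho> A)"

definition upS :: "(nat \<Rightarrow> tm) \<Rightarrow> nat \<Rightarrow> tm" where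
  "upS \<sigma> i = (case i of 0 \<Rightarrow> TmVar 0 | Suc j \<Rightarrow> renTm Suc (\<sigma> j))"

primrec substTy :: "(nat \<Rightarrow> tm) \<Rightarrow> ty \<Rightarrow> ty"
    and substTm :: "(nat \<Rightarrow> tm) \<Rightarrow> tm \<Rightarrow> tm" where
  "substTy \<sigma> (TyU l) = TyU l"
| "substTy \<sigma> (TyPi A B) = TyPi (substTy \<sigma> A) (substTy (upS \<sigma>) B)"
| "substTy \<sigma> (TySg A B) = TySg (substTy \<sigma> A) (substTy (upS \<sigma>) B)"
| "substTy \<sigma> (TyEl t) = TyEl (substTm \<sigma> t)"
| "substTm \<sigma> (TmVar i) = \<sigma> i"
| "substTm \<sigma> (TmLam A t) = TmLam (substTy \<sigma> A) (substTm (upS \<sigma>) t)"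
| "substTm \<sigma> (TmApp f a) = TmApp (substTm \<sigma> f) (substTm \<sigma> a)"
| "substTm \<sigma> (TmPair B a b) = TmPair (substTy (upS \<sigma>) B) (substTm \<sigma> a) (substTm \<sigma> b)"
| "substTm \<sigma> (TmFst p) = TmFst (substTm \<sigma> p)"
| "substTm \<sigma> (TmSnd p) = TmSnd (substTm \<sigma> p)"
| "substTm \<sigma> (TmCode A) = TmCode (substTy \<sigma> A)"

definition scons :: "tm \<Rightarrow> nat \<Rightarrow> tm" where
  "scons a i = (case i of 0 \<Rightarrow> a | Suc j \<Rightarrow> TmVar j)"

abbreviation instTy :: "ty \<Rightarrow> tm \<Rightarrow> ty" where
  "instTy B a \<equiv> substTy (scons a) B"

abbreviation instTm :: "tm \<Rightarrow> tm \<Rightarrow> tm" where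
  "instTm t a \<equiv> substTm (scons a) t"

definition varTy :: "ty list \<Rightarrow> nat \<Rightarrow> ty" where
  "varTy \<Gamma> i = renTy (\<lambda>j. j + Suc i) (\<Gamma> ! i)"

inductive wfCtx :: "ty list \<Rightarrow> bool"
  and isTy :: "ty list \<Rightarrow> ty \<Rightarrow> nat \<Rightarrow> bool"
  and hasTy :: "ty list \<Rightarrow> tm \<Rightarrow> ty \<Rightarrow> bool"
  and eqTy :: "ty list \<Rightarrow> ty \<Rightarrow> ty \<Rightarrow> nat \<Rightarrow> bool"
  and eqTm :: "ty list \<Rightarrow> tm \<Rightarrow> tm \<Rightarrow> ty \<Rightarrow> bool" where
  ctx_nil: "wfCtx []"
| ctx_ext: "isTy \<Gamma> A l \<Longrightarrow> wfCtx (A # \<Gamma>)"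
| ty_U: "wfCtx \<Gamma> \<Longrightarrow> isTy \<Gamma> (TyU l) (Suc l)"
| ty_Pi: "isTy \<Gamma> A l \<Longrightarrow> isTy (A # \<Gamma>) B l \<Longrightarrow> isTy \<Gamma> (TyPi A B) l"
| ty_Sg: "isTy \<Gamma> A l \<Longrightarrow> isTy (A # \<Gamma>) B l \<Longrightarrow> isTy \<Gamma> (TySg A B) l"
| ty_El: "hasTy \<Gamma> t (TyU l) \<Longrightarrow> isTy \<Gamma> (TyEl t) l"
| tm_var: "wfCtx \<Gamma> \<Longrightarrow> i < length \<Gamma> \<Longrightarrow> hasTy \<Gamma> (TmVar i) (varTy \<Gamma> i)"
| tm_lam: "isTy \<Gamma> A l \<Longrightarrow> isTy (A # \<Gamma>) B l \<Longrightarrow> hasTy (A # \<Gamma>) t B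
           \<Longrightarrow> hasTy \<Gamma> (TmLam A t) (TyPi A B)"
| tm_app: "hasTy \<Gamma> f (TyPi A B) \<Longrightarrow> hasTy \<Gamma> a A \<Longrightarrow> hasTy \<Gamma> (TmApp f a) (instTy B a)"
| tm_pair: "isTy \<Gamma> A l \<Longrightarrow> isTy (A # \<Gamma>) B l \<Longrightarrow> hasTy \<Gamma> a A \<Longrightarrow> hasTy \<Gamma> b (instTy B a)
           \<Longrightarrow> hasTy \<Gamma> (TmPair B a b) (TySg A B)"
| tm_fst: "hasTy \<Gamma> p (TySg A B) \<Longrightarrow> hasTy \<Gamma> (TmFst p) A"
| tm_snd: "hasTy \<Gamma> p (TySg A B) \<Longrightarrow> hasTy \<Gamma> (TmSnd p) (instTy B (TmFst p))"
| tm_code: "isTy \<Gamma> A l \<Longrightarrow> hasTy \<Gamma> (TmCode A) (TyU l)"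
| tm_conv: "hasTy \<Gamma> t A \<Longrightarrow> eqTy \<Gamma> A B l \<Longrightarrow> hasTy \<Gamma> t B"
| eqTy_refl: "isTy \<Gamma> A l \<Longrightarrow> eqTy \<Gamma> A A l"
| eqTy_sym: "eqTy \<Gamma> A B l \<Longrightarrow> eqTy \<Gamma> B A l"
| eqTy_trans: "eqTy \<Gamma> A B l \<Longrightarrow> eqTy \<Gamma> B C l \<Longrightarrow> eqTy \<Gamma> A C l"
| eqTy_Pi: "eqTy \<Gamma> A A' l \<Longrightarrow> eqTy (A # \<Gamma>) B B' l \<Longrightarrow> eqTy \<Gamma> (TyPi A B) (TyPi A' B') l"
| eqTy_Sg: "eqTy \<Gamma> A A' l \<Longrightarrow> eqTy (A # \<Gamma>) B B' l \<Longrightarrow> eqTy \<Gamma> (TySg A B) (TySg A' B') l"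
| eqTy_El: "eqTm \<Gamma> t t' (TyU l) \<Longrightarrow> eqTy \<Gamma> (TyEl t) (TyEl t') l"
| eqTy_ElCode: "isTy \<Gamma> A l \<Longrightarrow> eqTy \<Gamma> (TyEl (TmCode A)) A l"
| eqTm_refl: "hasTy \<Gamma> t A \<Longrightarrow> eqTm \<Gamma> t t A"
| eqTm_sym: "eqTm \<Gamma> t u A \<Longrightarrow> eqTm \<Gamma> u t A"
| eqTm_trans: "eqTm \<Gamma> t u A \<Longrightarrow> eqTm \<Gamma> u v A \<Longrightarrow> eqTm \<Gamma> t v A"
| eqTm_conv: "eqTm \<Gamma> t u A \<Longrightarrow> eqTy \<Gamma> A B l \<Longrightarrow> eqTm \<Gamma> t u B"
| eqTm_lam: "eqTy \<Gamma> A A' l \<Longrightarrow> isTy (A # \<Gamma>) B l \<Longrightarrow> eqTm (A # \<Gamma>) t t' B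
           \<Longrightarrow> eqTm \<Gamma> (TmLam A t) (TmLam A' t') (TyPi A B)"
| eqTm_app: "eqTm \<Gamma> f f' (TyPi A B) \<Longrightarrow> eqTm \<Gamma> a a' A
           \<Longrightarrow> eqTm \<Gamma> (TmApp f a) (TmApp f' a') (instTy B a)"
| eqTm_pair: "isTy \<Gamma> A l \<Longrightarrow> eqTy (A # \<Gamma>) B B' l \<Longrightarrow> eqTm \<Gamma> a a' A
           \<Longrightarrow> eqTm \<Gamma> b b' (instTy B a)
           \<Longrightarrow> eqTm \<Gamma> (TmPair B a b) (TmPair B' a' b') (TySg A B)"
| eqTm_fst: "eqTm \<Gamma> p p' (TySg A B) \<Longrightarrow> eqTm \<Gamma> (TmFst p) (TmFst p') A"
| eqTm_snd: "eqTm \<Gamma> p p' (TySg A B) \<Longrightarrow> eqTm \<Gamma> (TmSnd p) (TmSnd p') (instTy B (TmFst p))"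
| eqTm_code: "eqTy \<Gamma> A A' l \<Longrightarrow> eqTm \<Gamma> (TmCode A) (TmCode A') (TyU l)"
| eqTm_beta: "isTy \<Gamma> A l \<Longrightarrow> isTy (A # \<Gamma>) B l \<Longrightarrow> hasTy (A # \<Gamma>) t B \<Longrightarrow> hasTy \<Gamma> a A
           \<Longrightarrow> eqTm \<Gamma> (TmApp (TmLam A t) a) (instTm t a) (instTy B a)"
| eqTm_eta: "hasTy \<Gamma> f (TyPi A B)
           \<Longrightarrow> eqTm \<Gamma> f (TmLam A (TmApp (renTm Suc f) (TmVar 0))) (TyPi A B)"
| eqTm_fst_beta: "isTy \<Gamma> A l \<Longrightarrow> isTy (A # \<Gamma>) B l \<Longrightarrow> hasTy \<Gamma> a A \<Longrightarrow> hasTy \<Gamma> b (instTy B a)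
           \<Longrightarrow> eqTm \<Gamma> (TmFst (TmPair B a b)) a A"
| eqTm_snd_beta: "isTy \<Gamma> A l \<Longrightarrow> isTy (A # \<Gamma>) B l \<Longrightarrow> hasTy \<Gamma> a A \<Longrightarrow> hasTy \<Gamma> b (instTy B a)
           \<Longrightarrow> eqTm \<Gamma> (TmSnd (TmPair B a b)) b (instTy B a)"
| eqTm_sg_eta: "hasTy \<Gamma> p (TySg A B)
           \<Longrightarrow> eqTm \<Gamma> p (TmPair B (TmFst p) (TmSnd p)) (TySg A B)"
| eqTm_CodeEl: "hasTy \<Gamma> t (TyU l) \<Longrightarrow> eqTm \<Gamma> (TmCode (TyEl t)) t (TyU l)"

definition substOK :: "ty list \<Rightarrow> (nat \<Rightarrow> tm) \<Rightarrow> ty list \<Rightarrow> bool" where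
  "substOK \<Delta> \<sigma> \<Gamma> \<longleftrightarrow> wfCtx \<Delta> \<and>
     (\<forall>i < length \<Gamma>. hasTy \<Delta> (\<sigma> i) (substTy \<sigma> (varTy \<Gamma> i)))"

datatype mode = Er | Rt   \<comment> \<open>Er = mode 0 (erased), Rt = mode omega (runtime)\<close>

datatype ty0 = ZU nat | ZPi mode ty0 ty0 | ZSg mode ty0 ty0 | ZEl tm0
     and tm0 = ZVar nat | ZLam mode ty0 tm0 | ZApp mode tm0 tm0 | ZPair mode ty0 tm0 tm0
            | ZFst mode tm0 | ZSnd mode tm0 | ZCode ty0

text \<open>Context entries: a variable of a given mode, or the erasure marker. The marker binds no
  variable, so de Bruijn indices count only the Bind entries.\<close>
datatype centry = Bind mode ty0 | Mark

primrec renTy0 :: "(nat \<Rightarrow> nat) \<Rightarrow> ty0 \<Rightarrow> ty0"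
    and renTm0 :: "(nat \<Rightarrow> nat) \<Rightarrow> tm0 \<Rightarrow> tm0" where
  "renTy0 \<rho> (ZU l) = ZU l"
| "renTy0 \<rho> (ZPi m A B) = ZPi m (renTy0 \<rho> A) (renTy0 (liftR \<rho>) B)"
| "renTy0 \<rho> (ZSg m A B) = ZSg m (renTy0 \<rho> A) (renTy0 (liftR \<rho>) B)"
| "renTy0 \<rho> (ZEl t) = ZEl (renTm0 \<rho> t)"
| "renTm0 \<rho> (ZVar i) = ZVar (\<rho> i)"
| "renTm0 \<rho> (ZLam m A t) = ZLam m (renTy0 \<rho> A) (renTm0 (liftR \<rho>) t)"
| "renTm0 \<rho> (ZApp m f a) = ZApp m (renTm0 \<rho> f) (renTm0 \<rho> a)"
| "renTm0 \<rho> (ZPair m B a b) = ZPair m (renTy0 (liftR \<rho>) B) (renTm0 \<rho> a) (renTm0 \<rho> b)"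
| "renTm0 \<rho> (ZFst m p) = ZFst m (renTm0 \<rho> p)"
| "renTm0 \<rho> (ZSnd m p) = ZSnd m (renTm0 \<rho> p)"
| "renTm0 \<rho> (ZCode A) = ZCode (renTy0 \<rho> A)"

definition upS0 :: "(nat \<Rightarrow> tm0) \<Rightarrow> nat \<Rightarrow> tm0" where
  "upS0 \<sigma> i = (case i of 0 \<Rightarrow> ZVar 0 | Suc j \<Rightarrow> renTm0 Suc (\<sigma> j))"

primrec substTy0 :: "(nat \<Rightarrow> tm0) \<Rightarrow> ty0 \<Rightarrow> ty0"
    and substTm0 :: "(nat \<Rightarrow> tm0) \<Rightarrow> tm0 \<Rightarrow> tm0" where
  "substTy0 \<sigma> (ZU l) = ZU l"
| "substTy0 \<sigma> (ZPi m A B) = ZPi m (substTy0 \<sigma> A) (substTy0 (upS0 \<sigma>) B)"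
| "substTy0 \<sigma> (ZSg m A B) = ZSg m (substTy0 \<sigma> A) (substTy0 (upS0 \<sigma>) B)"
| "substTy0 \<sigma> (ZEl t) = ZEl (substTm0 \<sigma> t)"
| "substTm0 \<sigma> (ZVar i) = \<sigma> i"
| "substTm0 \<sigma> (ZLam m A t) = ZLam m (substTy0 \<sigma> A) (substTm0 (upS0 \<sigma>) t)"
| "substTm0 \<sigma> (ZApp m f a) = ZApp m (substTm0 \<sigma> f) (substTm0 \<sigma> a)"
| "substTm0 \<sigma> (ZPair m B a b) = ZPair m (substTy0 (upS0 \<sigma>) B) (substTm0 \<sigma> a) (substTm0 \<sigma> b)"
| "substTm0 \<sigma> (ZFst m p) = ZFst m (substTm0 \<sigma> p)"
| "substTm0 \<sigma> (ZSnd m p) = ZSnd m (substTm0 \<sigma> p)"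
| "substTm0 \<sigma> (ZCode A) = ZCode (substTy0 \<sigma> A)"

definition scons0 :: "tm0 \<Rightarrow> nat \<Rightarrow> tm0" where
  "scons0 a i = (case i of 0 \<Rightarrow> a | Suc j \<Rightarrow> ZVar j)"

abbreviation instTy0 :: "ty0 \<Rightarrow> tm0 \<Rightarrow> ty0" where
  "instTy0 B a \<equiv> substTy0 (scons0 a) B"

abbreviation instTm0 :: "tm0 \<Rightarrow> tm0 \<Rightarrow> tm0" where
  "instTm0 t a \<equiv> substTm0 (scons0 a) t"

fun binds :: "centry list \<Rightarrow> (mode \<times> ty0) list" where
  "binds [] = []"
| "binds (Bind m A # \<Gamma>) = (m, A) # binds \<Gamma>"
| "binds (Mark # \<Gamma>) = binds \<Gamma>"

text \<open>mark Gamma is the context Gamma extended by #; since the marker is a proposition, adding it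
  to a context that already contains it changes nothing.\<close>
definition mark :: "centry list \<Rightarrow> centry list" where
  "mark \<Gamma> = (if Mark \<in> set \<Gamma> then \<Gamma> else Mark # \<Gamma>)"

text \<open>The context in which a mode-m component is (runtime-)typed: terms of mode 0 in
  context Gamma are runtime terms in Gamma extended with the marker.\<close>
definition atMode :: "mode \<Rightarrow> centry list \<Rightarrow> centry list" where
  "atMode m \<Gamma> = (case m of Er \<Rightarrow> mark \<Gamma> | Rt \<Rightarrow> \<Gamma>)"

definition varTy0 :: "centry list \<Rightarrow> nat \<Rightarrow> ty0" where
  "varTy0 \<Gamma> i = renTy0 (\<lambda>j. j + Suc i) (snd (binds \<Gamma> ! i))"

text \<open>hasTy0 / eqTm0 are the runtime (mode omega) judgements.\<close>
inductive wfCtx0 :: "centry list \<Rightarrow> bool"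
  and isTy0 :: "centry list \<Rightarrow> ty0 \<Rightarrow> nat \<Rightarrow> bool"
  and hasTy0 :: "centry list \<Rightarrow> tm0 \<Rightarrow> ty0 \<Rightarrow> bool"
  and eqTy0 :: "centry list \<Rightarrow> ty0 \<Rightarrow> ty0 \<Rightarrow> nat \<Rightarrow> bool"
  and eqTm0 :: "centry list \<Rightarrow> tm0 \<Rightarrow> tm0 \<Rightarrow> ty0 \<Rightarrow> bool" where
  ctx0_nil: "wfCtx0 []"
| ctx0_bind: "isTy0 \<Gamma> A l \<Longrightarrow> wfCtx0 (Bind m A # \<Gamma>)"
| ctx0_mark: "wfCtx0 \<Gamma> \<Longrightarrow> wfCtx0 (Mark # \<Gamma>)"
| ty0_U: "wfCtx0 \<Gamma> \<Longrightarrow> isTy0 \<Gamma> (ZU l) (Suc l)"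
| ty0_Pi: "isTy0 \<Gamma> A l \<Longrightarrow> isTy0 (Bind m A # \<Gamma>) B l \<Longrightarrow> isTy0 \<Gamma> (ZPi m A B) l"
| ty0_Sg: "isTy0 \<Gamma> A l \<Longrightarrow> isTy0 (Bind m A # \<Gamma>) B l \<Longrightarrow> isTy0 \<Gamma> (ZSg m A B) l"
| ty0_El: "hasTy0 (mark \<Gamma>) t (ZU l) \<Longrightarrow> isTy0 \<Gamma> (ZEl t) l"
| tm0_var: "wfCtx0 \<Gamma> \<Longrightarrow> i < length (binds \<Gamma>)
           \<Longrightarrow> fst (binds \<Gamma> ! i) = Rt \<or> Mark \<in> set \<Gamma>
           \<Longrightarrow> hasTy0 \<Gamma> (ZVar i) (varTy0 \<Gamma> i)"
| tm0_lam: "isTy0 \<Gamma> A l \<Longrightarrow> isTy0 (Bind m A # \<Gamma>) B l \<Longrightarrow> hasTy0 (Bind m A # \<Gamma>) t B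
           \<Longrightarrow> hasTy0 \<Gamma> (ZLam m A t) (ZPi m A B)"
| tm0_app: "hasTy0 \<Gamma> f (ZPi m A B) \<Longrightarrow> hasTy0 (atMode m \<Gamma>) a A
           \<Longrightarrow> hasTy0 \<Gamma> (ZApp m f a) (instTy0 B a)"
| tm0_pair: "isTy0 \<Gamma> A l \<Longrightarrow> isTy0 (Bind m A # \<Gamma>) B l \<Longrightarrow> hasTy0 (atMode m \<Gamma>) a A
           \<Longrightarrow> hasTy0 \<Gamma> b (instTy0 B a) \<Longrightarrow> hasTy0 \<Gamma> (ZPair m B a b) (ZSg m A B)"
| tm0_fst: "hasTy0 \<Gamma> p (ZSg m A B) \<Longrightarrow> hasTy0 (atMode m \<Gamma>) (ZFst m p) A"
| tm0_snd: "hasTy0 \<Gamma> p (ZSg m A B) \<Longrightarrow> hasTy0 \<Gamma> (ZSnd m p) (instTy0 B (ZFst m p))"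
| tm0_code: "isTy0 \<Gamma> A l \<Longrightarrow> Mark \<in> set \<Gamma> \<Longrightarrow> hasTy0 \<Gamma> (ZCode A) (ZU l)"
| tm0_conv: "hasTy0 \<Gamma> t A \<Longrightarrow> eqTy0 \<Gamma> A B l \<Longrightarrow> hasTy0 \<Gamma> t B"
| eqTy0_refl: "isTy0 \<Gamma> A l \<Longrightarrow> eqTy0 \<Gamma> A A l"
| eqTy0_sym: "eqTy0 \<Gamma> A B l \<Longrightarrow> eqTy0 \<Gamma> B A l"
| eqTy0_trans: "eqTy0 \<Gamma> A B l \<Longrightarrow> eqTy0 \<Gamma> B C l \<Longrightarrow> eqTy0 \<Gamma> A C l"
| eqTy0_Pi: "eqTy0 \<Gamma> A A' l \<Longrightarrow> eqTy0 (Bind m A # \<Gamma>) B B' l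
           \<Longrightarrow> eqTy0 \<Gamma> (ZPi m A B) (ZPi m A' B') l"
| eqTy0_Sg: "eqTy0 \<Gamma> A A' l \<Longrightarrow> eqTy0 (Bind m A # \<Gamma>) B B' l
           \<Longrightarrow> eqTy0 \<Gamma> (ZSg m A B) (ZSg m A' B') l"
| eqTy0_El: "eqTm0 (mark \<Gamma>) t t' (ZU l) \<Longrightarrow> eqTy0 \<Gamma> (ZEl t) (ZEl t') l"
| eqTy0_ElCode: "isTy0 \<Gamma> A l \<Longrightarrow> eqTy0 \<Gamma> (ZEl (ZCode A)) A l"
| eqTm0_refl: "hasTy0 \<Gamma> t A \<Longrightarrow> eqTm0 \<Gamma> t t A"
| eqTm0_sym: "eqTm0 \<Gamma> t u A \<Longrightarrow> eqTm0 \<Gamma> u t A"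
| eqTm0_trans: "eqTm0 \<Gamma> t u A \<Longrightarrow> eqTm0 \<Gamma> u v A \<Longrightarrow> eqTm0 \<Gamma> t v A"
| eqTm0_conv: "eqTm0 \<Gamma> t u A \<Longrightarrow> eqTy0 \<Gamma> A B l \<Longrightarrow> eqTm0 \<Gamma> t u B"
| eqTm0_lam: "eqTy0 \<Gamma> A A' l \<Longrightarrow> isTy0 (Bind m A # \<Gamma>) B l \<Longrightarrow> eqTm0 (Bind m A # \<Gamma>) t t' B
           \<Longrightarrow> eqTm0 \<Gamma> (ZLam m A t) (ZLam m A' t') (ZPi m A B)"
| eqTm0_app: "eqTm0 \<Gamma> f f' (ZPi m A B) \<Longrightarrow> eqTm0 (atMode m \<Gamma>) a a' A
           \<Longrightarrow> eqTm0 \<Gamma> (ZApp m f a) (ZApp m f' a') (instTy0 B a)"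
| eqTm0_pair: "isTy0 \<Gamma> A l \<Longrightarrow> eqTy0 (Bind m A # \<Gamma>) B B' l \<Longrightarrow> eqTm0 (atMode m \<Gamma>) a a' A
           \<Longrightarrow> eqTm0 \<Gamma> b b' (instTy0 B a)
           \<Longrightarrow> eqTm0 \<Gamma> (ZPair m B a b) (ZPair m B' a' b') (ZSg m A B)"
| eqTm0_fst: "eqTm0 \<Gamma> p p' (ZSg m A B) \<Longrightarrow> eqTm0 (atMode m \<Gamma>) (ZFst m p) (ZFst m p') A"
| eqTm0_snd: "eqTm0 \<Gamma> p p' (ZSg m A B)
           \<Longrightarrow> eqTm0 \<Gamma> (ZSnd m p) (ZSnd m p') (instTy0 B (ZFst m p))"
| eqTm0_code: "eqTy0 \<Gamma> A A' l \<Longrightarrow> Mark \<in> set \<Gamma> \<Longrightarrow> eqTm0 \<Gamma> (ZCode A) (ZCode A') (ZU l)"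
| eqTm0_beta: "isTy0 \<Gamma> A l \<Longrightarrow> isTy0 (Bind m A # \<Gamma>) B l \<Longrightarrow> hasTy0 (Bind m A # \<Gamma>) t B
           \<Longrightarrow> hasTy0 (atMode m \<Gamma>) a A
           \<Longrightarrow> eqTm0 \<Gamma> (ZApp m (ZLam m A t) a) (instTm0 t a) (instTy0 B a)"
| eqTm0_eta: "hasTy0 \<Gamma> f (ZPi m A B)
           \<Longrightarrow> eqTm0 \<Gamma> f (ZLam m A (ZApp m (renTm0 Suc f) (ZVar 0))) (ZPi m A B)"
| eqTm0_fst_beta: "isTy0 \<Gamma> A l \<Longrightarrow> isTy0 (Bind m A # \<Gamma>) B l \<Longrightarrow> hasTy0 (atMode m \<Gamma>) a A
           \<Longrightarrow> hasTy0 \<Gamma> b (instTy0 B a)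
           \<Longrightarrow> eqTm0 (atMode m \<Gamma>) (ZFst m (ZPair m B a b)) a A"
| eqTm0_snd_beta: "isTy0 \<Gamma> A l \<Longrightarrow> isTy0 (Bind m A # \<Gamma>) B l \<Longrightarrow> hasTy0 (atMode m \<Gamma>) a A
           \<Longrightarrow> hasTy0 \<Gamma> b (instTy0 B a)
           \<Longrightarrow> eqTm0 \<Gamma> (ZSnd m (ZPair m B a b)) b (instTy0 B a)"
| eqTm0_sg_eta: "hasTy0 \<Gamma> p (ZSg m A B)
           \<Longrightarrow> eqTm0 \<Gamma> p (ZPair m B (ZFst m p) (ZSnd m p)) (ZSg m A B)"
| eqTm0_CodeEl: "hasTy0 \<Gamma> t (ZU l) \<Longrightarrow> Mark \<in> set \<Gamma> \<Longrightarrow> eqTm0 \<Gamma> (ZCode (ZEl t)) t (ZU l)"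

definition hasTy0E :: "centry list \<Rightarrow> tm0 \<Rightarrow> ty0 \<Rightarrow> bool" where
  "hasTy0E \<Gamma> t A \<longleftrightarrow> hasTy0 (mark \<Gamma>) t A"

definition eqTm0E :: "centry list \<Rightarrow> tm0 \<Rightarrow> tm0 \<Rightarrow> ty0 \<Rightarrow> bool" where
  "eqTm0E \<Gamma> t u A \<longleftrightarrow> eqTm0 (mark \<Gamma>) t u A"

primrec floorTy :: "ty0 \<Rightarrow> ty" and floorTm :: "tm0 \<Rightarrow> tm" where
  "floorTy (ZU l) = TyU l"
| "floorTy (ZPi m A B) = TyPi (floorTy A) (floorTy B)"
| "floorTy (ZSg m A B) = TySg (floorTy A) (floorTy B)"
| "floorTy (ZEl t) = TyEl (floorTm t)"
| "floorTm (ZVar i) = TmVar i"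
| "floorTm (ZLam m A t) = TmLam (floorTy A) (floorTm t)"
| "floorTm (ZApp m f a) = TmApp (floorTm f) (floorTm a)"
| "floorTm (ZPair m B a b) = TmPair (floorTy B) (floorTm a) (floorTm b)"
| "floorTm (ZFst m p) = TmFst (floorTm p)"
| "floorTm (ZSnd m p) = TmSnd (floorTm p)"
| "floorTm (ZCode A) = TmCode (floorTy A)"

primrec angTy :: "ty \<Rightarrow> ty0" and angTm :: "tm \<Rightarrow> tm0" where
  "angTy (TyU l) = ZU l"
| "angTy (TyPi A B) = ZPi Er (angTy A) (angTy B)"
| "angTy (TySg A B) = ZSg Er (angTy A) (angTy B)"
| "angTy (TyEl t) = ZEl (angTm t)"
| "angTm (TmVar i) = ZVar i"
| "angTm (TmLam A t) = ZLam Er (angTy A) (angTm t)"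
| "angTm (TmApp f a) = ZApp Er (angTm f) (angTm a)"
| "angTm (TmPair B a b) = ZPair Er (angTy B) (angTm a) (angTm b)"
| "angTm (TmFst p) = ZFst Er (angTm p)"
| "angTm (TmSnd p) = ZSnd Er (angTm p)"
| "angTm (TmCode A) = ZCode (angTy A)"

definition angCtx :: "ty list \<Rightarrow> centry list" where
  "angCtx \<Gamma> = map (\<lambda>A. Bind Er (angTy A)) \<Gamma>"

end

(* The floor map commutes with substitution and is a left inverse of the erased interpretation already on raw
   syntax. Surjectivity therefore only needs the erased interpretation to preserve typing, and
   naturality only the substitution lemma of TT. The one obstacle is that going under a binder in a
   marked context puts the marker below the new variable rather than on top; derivability turns
   out not to depend on where the marker sits. *)
theory Submission
  imports Defs
begin

section \<open>Substitution calculus of TT\<close>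

text \<open>Naturality is an equality of raw terms, yet \<open>eqTm\<close> is reflexive only on
  typed terms; this is why a substitution lemma is proved at all. A direct induction for it would be
  circular, because lifting a substitution under a binder weakens its terms, so renamings have to be
  treated before general substitutions. Presuppositions, such as both sides of a type equality being
  types, are not derived separately; the induction recovers what it needs from the contexts. For TT0
  no typed substitution lemma is required, since both interpretations send rules to rules up to the
  place of the marker. The place cannot matter because the side conditions only ask whether
  \<open>Mark\<close> occurs in the context, never where.\<close>

lemma liftR_simps [simp]: "liftR \<rho> 0 = 0" "liftR \<rho> (Suc i) = Suc (\<rho> i)"
  by (simp_all add: liftR_def)

lemma upS_simps [simp]: "upS \<sigma> 0 = TmVar 0" "upS \<sigma> (Suc i) = renTm Suc (\<sigma> i)"
  by (simp_all add: upS_def)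

lemma scons_simps [simp]: "scons a 0 = a" "scons a (Suc i) = TmVar i"
  by (simp_all add: scons_def)

lemma liftR_comp: "liftR \<rho> \<circ> liftR \<rho>' = liftR (\<rho> \<circ> \<rho>')"
  by (simp add: fun_eq_iff liftR_def split: nat.split)

lemma upS_liftR: "upS \<sigma> \<circ> liftR \<rho> = upS (\<sigma> \<circ> \<rho>)"
  by (simp add: fun_eq_iff liftR_def upS_def split: nat.split)

lemma upS_TmVar: "upS (TmVar \<circ> \<rho>) = TmVar \<circ> liftR \<rho>"
  by (simp add: fun_eq_iff liftR_def upS_def split: nat.split)

text \<open>The composition laws depend on each other through binders: \<open>ren_subst\<close>
  needs \<open>ren_ren\<close>, and \<open>subst_subst\<close> needs both \<open>subst_ren\<close>
  and \<open>ren_subst\<close>, because a lifted substitution contains a weakening.\<close>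

lemma ren_ren:
  "renTy \<rho> (renTy \<rho>' A) = renTy (\<rho> \<circ> \<rho>') A"
  "renTm \<rho> (renTm \<rho>' t) = renTm (\<rho> \<circ> \<rho>') t"
  by (induction A and t arbitrary: \<rho> \<rho>' and \<rho> \<rho>') (simp_all add: liftR_comp)

text \<open>Lets stability under renaming be read off from a statement about substitutions, so that
  typing needs a single induction.\<close>

lemma ren_eq_subst:
  "renTy \<rho> A = substTy (TmVar \<circ> \<rho>) A"
  "renTm \<rho> t = substTm (TmVar \<circ> \<rho>) t"
  by (induction A and t arbitrary: \<rho> and \<rho>) (simp_all add: upS_TmVar)

lemma subst_ren:
  "substTy \<sigma> (renTy \<rho> A) = substTy (\<sigma> \<circ> \<rho>) A"
  "substTm \<sigma> (renTm \<rho> t) = substTm (\<sigma> \<circ> \<rho>) t"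
  by (induction A and t arbitrary: \<sigma> \<rho> and \<sigma> \<rho>) (simp_all add: upS_liftR)

lemma renTm_liftR_upS: "renTm (liftR \<rho>) \<circ> upS \<sigma> = upS (renTm \<rho> \<circ> \<sigma>)"
proof
  fix i show "(renTm (liftR \<rho>) \<circ> upS \<sigma>) i = upS (renTm \<rho> \<circ> \<sigma>) i"
    by (cases i) (simp_all add: ren_ren comp_def)
qed

lemma ren_subst:
  "renTy \<rho> (substTy \<sigma> A) = substTy (renTm \<rho> \<circ> \<sigma>) A"
  "renTm \<rho> (substTm \<sigma> t) = substTm (renTm \<rho> \<circ> \<sigma>) t"
  by (induction A and t arbitrary: \<sigma> \<rho> and \<sigma> \<rho>) (simp_all add: renTm_liftR_upS)

lemma substTy_upS_weaken: "substTy (upS \<sigma>) (renTy Suc A) = renTy Suc (substTy \<sigma> A)"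
  and substTm_upS_weaken: "substTm (upS \<sigma>) (renTm Suc t) = renTm Suc (substTm \<sigma> t)"
  by (simp_all add: subst_ren ren_subst comp_def)

lemma substTm_upS_upS: "substTm (upS \<tau>) \<circ> upS \<sigma> = upS (substTm \<tau> \<circ> \<sigma>)"
proof
  fix i show "(substTm (upS \<tau>) \<circ> upS \<sigma>) i = upS (substTm \<tau> \<circ> \<sigma>) i"
    by (cases i) (simp_all add: substTm_upS_weaken)
qed

lemma subst_subst:
  "substTy \<tau> (substTy \<sigma> A) = substTy (substTm \<tau> \<circ> \<sigma>) A"
  "substTm \<tau> (substTm \<sigma> t) = substTm (substTm \<tau> \<circ> \<sigma>) t"
  by (induction A and t arbitrary: \<sigma> \<tau> and \<sigma> \<tau>) (simp_all add: substTm_upS_upS)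

lemma upS_TmVar_id: "upS TmVar = TmVar"
  by (simp add: fun_eq_iff upS_def split: nat.split)

lemma subst_TmVar [simp]: "substTy TmVar A = A" "substTm TmVar t = t"
  by (induction A and t) (simp_all add: upS_TmVar_id)

text \<open>At \<open>0\<close> both sides give the substituted \<open>a\<close>; at a successor the
  instantiation on the right cancels the weakening introduced by \<open>upS\<close>. This is what
  makes the dependent result types of application, pairing and second projection commute with
  substitution.\<close>

lemma subst_scons: "substTm \<sigma> \<circ> scons a = substTm (scons (substTm \<sigma> a)) \<circ> upS \<sigma>"
proof
  fix i show "(substTm \<sigma> \<circ> scons a) i = (substTm (scons (substTm \<sigma> a)) \<circ> upS \<sigma>) i"
    by (cases i) (simp_all add: subst_ren comp_def)
qed

lemma substTy_instTy: "substTy \<sigma> (instTy B a) = instTy (substTy (upS \<sigma>) B) (substTm \<sigma> a)"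
  and substTm_instTm: "substTm \<sigma> (instTm t a) = instTm (substTm (upS \<sigma>) t) (substTm \<sigma> a)"
  by (simp_all add: subst_subst subst_scons)

lemma varTy_Cons [simp]:
  "varTy (A # \<Gamma>) 0 = renTy Suc A"
  "varTy (A # \<Gamma>) (Suc i) = renTy Suc (varTy \<Gamma> i)"
  by (simp_all add: varTy_def ren_ren comp_def)

section \<open>Typing is stable under substitution\<close>

text \<open>Premises of binder congruence rules such as \<open>eqTy_Pi\<close> only supply an equation \<open>A = A'\<close>,
  not that \<open>A\<close> is a type, which is needed to go under the binder. It is recovered from the
  well-formed context \<open>A # \<Gamma>\<close> of the second premise, so stability of the head of the
  context is carried along in the induction.\<close>

definition head_stable :: "(ty list \<Rightarrow> (nat \<Rightarrow> tm) \<Rightarrow> ty list \<Rightarrow> bool) \<Rightarrow> ty list \<Rightarrow> bool" where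
  "head_stable R \<Gamma> \<longleftrightarrow> (\<forall>A \<Gamma>'. \<Gamma> = A # \<Gamma>' \<longrightarrow>
     (\<exists>l. \<forall>\<Delta> \<sigma>. R \<Delta> \<sigma> \<Gamma>' \<longrightarrow> isTy \<Delta> (substTy \<sigma> A) l))"

lemma head_stable_Cons:
  "head_stable R (A # \<Gamma>) \<longleftrightarrow> (\<exists>l. \<forall>\<Delta> \<sigma>. R \<Delta> \<sigma> \<Gamma> \<longrightarrow> isTy \<Delta> (substTy \<sigma> A) l)"
  by (simp add: head_stable_def)

text \<open>Abstracting the class \<open>R\<close> of substitutions lets one induction serve both renamings and,
  once weakening is available, arbitrary substitutions.\<close>

lemma typing_stable:
  assumes wf: "\<And>\<Delta> \<sigma> \<Gamma>. R \<Delta> \<sigma> \<Gamma> \<Longrightarrow> wfCtx \<Delta>"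
    and var: "\<And>\<Delta> \<sigma> \<Gamma> i. R \<Delta> \<sigma> \<Gamma> \<Longrightarrow> i < length \<Gamma> \<Longrightarrow>
                hasTy \<Delta> (\<sigma> i) (substTy \<sigma> (varTy \<Gamma> i))"
    and up: "\<And>\<Delta> \<sigma> \<Gamma> A l. R \<Delta> \<sigma> \<Gamma> \<Longrightarrow> isTy \<Delta> (substTy \<sigma> A) l \<Longrightarrow>
                R (substTy \<sigma> A # \<Delta>) (upS \<sigma>) (A # \<Gamma>)"
  shows "wfCtx \<Gamma> \<Longrightarrow> head_stable R \<Gamma>"
    and "isTy \<Gamma> A l \<Longrightarrow>
      head_stable R \<Gamma> \<and> (\<forall>\<Delta> \<sigma>. R \<Delta> \<sigma> \<Gamma> \<longrightarrow> isTy \<Delta> (substTy \<sigma> A) l)"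
    and "hasTy \<Gamma> t A \<Longrightarrow>
      head_stable R \<Gamma> \<and> (\<forall>\<Delta> \<sigma>. R \<Delta> \<sigma> \<Gamma> \<longrightarrow> hasTy \<Delta> (substTm \<sigma> t) (substTy \<sigma> A))"
    and "eqTy \<Gamma> A B l \<Longrightarrow>
      head_stable R \<Gamma> \<and> (\<forall>\<Delta> \<sigma>. R \<Delta> \<sigma> \<Gamma> \<longrightarrow> eqTy \<Delta> (substTy \<sigma> A) (substTy \<sigma> B) l)"
    and "eqTm \<Gamma> t u A \<Longrightarrow>
      head_stable R \<Gamma> \<and>
      (\<forall>\<Delta> \<sigma>. R \<Delta> \<sigma> \<Gamma> \<longrightarrow> eqTm \<Delta> (substTm \<sigma> t) (substTm \<sigma> u) (substTy \<sigma> A))"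
proof (induction rule: wfCtx_isTy_hasTy_eqTy_eqTm.inducts)
  case ctx_nil
  then show ?case by (simp add: head_stable_def)
next
  case (ctx_ext \<Gamma> A l)
  then show ?case by (auto simp: head_stable_Cons)
next
  case (ty_U \<Gamma> l)
  then show ?case by (auto intro: wf wfCtx_isTy_hasTy_eqTy_eqTm.ty_U)
next
  case (ty_Pi \<Gamma> A l B)
  then show ?case by (simp, blast intro: wfCtx_isTy_hasTy_eqTy_eqTm.ty_Pi up)
next
  case (ty_Sg \<Gamma> A l B)
  then show ?case by (simp, blast intro: wfCtx_isTy_hasTy_eqTy_eqTm.ty_Sg up)
next
  case (ty_El \<Gamma> t l)
  then show ?case by (auto intro: wfCtx_isTy_hasTy_eqTy_eqTm.ty_El)
next
  case (tm_var \<Gamma> i)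
  then show ?case by (auto intro: var)
next
  case (tm_lam \<Gamma> A l B t)
  then show ?case by (simp, blast intro: wfCtx_isTy_hasTy_eqTy_eqTm.tm_lam up)
next
  case (tm_app \<Gamma> f A B a)
  then show ?case
    by (simp add: substTy_instTy, blast intro: wfCtx_isTy_hasTy_eqTy_eqTm.tm_app)
next
  case (tm_pair \<Gamma> A l B a b)
  then show ?case
    by (simp add: substTy_instTy, blast intro: wfCtx_isTy_hasTy_eqTy_eqTm.tm_pair up)
next
  case (tm_fst \<Gamma> p A B)
  then show ?case by (auto intro: wfCtx_isTy_hasTy_eqTy_eqTm.tm_fst)
next
  case (tm_snd \<Gamma> p A B)
  then show ?case
    by (simp add: substTy_instTy, blast intro: wfCtx_isTy_hasTy_eqTy_eqTm.tm_snd)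
next
  case (tm_code \<Gamma> A l)
  then show ?case by (auto intro: wfCtx_isTy_hasTy_eqTy_eqTm.tm_code)
next
  case (tm_conv \<Gamma> t A B l)
  then show ?case by (blast intro: wfCtx_isTy_hasTy_eqTy_eqTm.tm_conv)
next
  case (eqTy_refl \<Gamma> A l)
  then show ?case by (auto intro: wfCtx_isTy_hasTy_eqTy_eqTm.eqTy_refl)
next
  case (eqTy_sym \<Gamma> A B l)
  then show ?case by (auto intro: wfCtx_isTy_hasTy_eqTy_eqTm.eqTy_sym)
next
  case (eqTy_trans \<Gamma> A B l C)
  then show ?case by (blast intro: wfCtx_isTy_hasTy_eqTy_eqTm.eqTy_trans)
next
  case (eqTy_Pi \<Gamma> A A' l B B')
  then show ?case
    by (simp add: head_stable_Cons, blast intro: wfCtx_isTy_hasTy_eqTy_eqTm.eqTy_Pi up)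
next
  case (eqTy_Sg \<Gamma> A A' l B B')
  then show ?case
    by (simp add: head_stable_Cons, blast intro: wfCtx_isTy_hasTy_eqTy_eqTm.eqTy_Sg up)
next
  case (eqTy_El \<Gamma> t t' l)
  then show ?case by (auto intro: wfCtx_isTy_hasTy_eqTy_eqTm.eqTy_El)
next
  case (eqTy_ElCode \<Gamma> A l)
  then show ?case by (auto intro: wfCtx_isTy_hasTy_eqTy_eqTm.eqTy_ElCode)
next
  case (eqTm_refl \<Gamma> t A)
  then show ?case by (auto intro: wfCtx_isTy_hasTy_eqTy_eqTm.eqTm_refl)
next
  case (eqTm_sym \<Gamma> t u A)
  then show ?case by (auto intro: wfCtx_isTy_hasTy_eqTy_eqTm.eqTm_sym)
next
  case (eqTm_trans \<Gamma> t u A v)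
  then show ?case by (blast intro: wfCtx_isTy_hasTy_eqTy_eqTm.eqTm_trans)
next
  case (eqTm_conv \<Gamma> t u A B l)
  then show ?case by (blast intro: wfCtx_isTy_hasTy_eqTy_eqTm.eqTm_conv)
next
  case (eqTm_lam \<Gamma> A A' l B t t')
  then show ?case
    by (simp add: head_stable_Cons, blast intro: wfCtx_isTy_hasTy_eqTy_eqTm.eqTm_lam up)
next
  case (eqTm_app \<Gamma> f f' A B a a')
  then show ?case
    by (simp add: substTy_instTy, blast intro: wfCtx_isTy_hasTy_eqTy_eqTm.eqTm_app)
next
  case (eqTm_pair \<Gamma> A l B B' a a' b b')
  then show ?case
    by (simp add: substTy_instTy, blast intro: wfCtx_isTy_hasTy_eqTy_eqTm.eqTm_pair up)
next
  case (eqTm_fst \<Gamma> p p' A B)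
  then show ?case by (auto intro: wfCtx_isTy_hasTy_eqTy_eqTm.eqTm_fst)
next
  case (eqTm_snd \<Gamma> p p' A B)
  then show ?case
    by (simp add: substTy_instTy, blast intro: wfCtx_isTy_hasTy_eqTy_eqTm.eqTm_snd)
next
  case (eqTm_code \<Gamma> A A' l)
  then show ?case by (auto intro: wfCtx_isTy_hasTy_eqTy_eqTm.eqTm_code)
next
  case (eqTm_beta \<Gamma> A l B t a)
  then show ?case
    by (simp add: substTy_instTy substTm_instTm, blast intro: wfCtx_isTy_hasTy_eqTy_eqTm.eqTm_beta up)
next
  case (eqTm_eta \<Gamma> f A B)
  \<comment> \<open>The image of an eta expansion must again be one: \<open>upS\<close> fixes the
    bound variable and sends the weakened \<open>f\<close> to the weakening of its image.\<close>
  then show ?case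
    by (simp add: substTm_upS_weaken, blast intro: wfCtx_isTy_hasTy_eqTy_eqTm.eqTm_eta)
next
  case (eqTm_fst_beta \<Gamma> A l B a b)
  then show ?case
    by (simp add: substTy_instTy, blast intro: wfCtx_isTy_hasTy_eqTy_eqTm.eqTm_fst_beta up)
next
  case (eqTm_snd_beta \<Gamma> A l B a b)
  then show ?case
    by (simp add: substTy_instTy, blast intro: wfCtx_isTy_hasTy_eqTy_eqTm.eqTm_snd_beta up)
next
  case (eqTm_sg_eta \<Gamma> p A B)
  then show ?case by (auto intro: wfCtx_isTy_hasTy_eqTy_eqTm.eqTm_sg_eta)
next
  case (eqTm_CodeEl \<Gamma> t l)
  then show ?case by (auto intro: wfCtx_isTy_hasTy_eqTy_eqTm.eqTm_CodeEl)
qed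

text \<open>The types of variables have to match syntactically, so \<open>tm_var\<close> alone types
  the image of a variable and lifting requires no prior weakening lemma. This breaks the circularity
  between weakening and substitution.\<close>

definition renOK :: "ty list \<Rightarrow> (nat \<Rightarrow> nat) \<Rightarrow> ty list \<Rightarrow> bool" where
  "renOK \<Delta> \<rho> \<Gamma> \<longleftrightarrow> wfCtx \<Delta> \<and>
     (\<forall>i < length \<Gamma>. \<rho> i < length \<Delta> \<and> varTy \<Delta> (\<rho> i) = renTy \<rho> (varTy \<Gamma> i))"

lemma renOK_liftR:
  assumes "renOK \<Delta> \<rho> \<Gamma>" and "isTy \<Delta> (renTy \<rho> A) l"
  shows "renOK (renTy \<rho> A # \<Delta>) (liftR \<rho>) (A # \<Gamma>)"
  using assms unfolding renOK_def
  by (auto simp: less_Suc_eq_0_disj ren_ren comp_def intro: ctx_ext)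

lemma hasTy_ren:
  assumes "hasTy \<Gamma> t A" and "renOK \<Delta> \<rho> \<Gamma>"
  shows "hasTy \<Delta> (renTm \<rho> t) (renTy \<rho> A)"
proof -
  \<comment> \<open>The first use of \<open>typing_stable\<close> takes the class of substitutions
    that consist of variables only.\<close>
  define R where "R \<Delta> \<sigma> \<Gamma> \<longleftrightarrow> (\<exists>\<rho>. \<sigma> = TmVar \<circ> \<rho> \<and> renOK \<Delta> \<rho> \<Gamma>)" for \<Delta> \<sigma> \<Gamma>
  have "head_stable R \<Gamma> \<and>
      (\<forall>\<Delta> \<sigma>. R \<Delta> \<sigma> \<Gamma> \<longrightarrow> hasTy \<Delta> (substTm \<sigma> t) (substTy \<sigma> A))"
  proof (rule typing_stable(3)[OF _ _ _ assms(1)])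
    show "wfCtx \<Delta>" if "R \<Delta> \<sigma> \<Gamma>" for \<Delta> \<sigma> \<Gamma>
      using that by (auto simp: R_def renOK_def)
    show "hasTy \<Delta> (\<sigma> i) (substTy \<sigma> (varTy \<Gamma> i))"
      if R: "R \<Delta> \<sigma> \<Gamma>" and i: "i < length \<Gamma>" for \<Delta> \<sigma> \<Gamma> i
    proof -
      obtain \<rho> where \<rho>: "\<sigma> = TmVar \<circ> \<rho>" "renOK \<Delta> \<rho> \<Gamma>"
        using R by (auto simp: R_def)
      with i have "wfCtx \<Delta>" "\<rho> i < length \<Delta>" "varTy \<Delta> (\<rho> i) = renTy \<rho> (varTy \<Gamma> i)"
        by (auto simp: renOK_def)
      then show ?thesis
        using tm_var[of \<Delta> "\<rho> i"] \<rho>(1) by (simp add: ren_eq_subst)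
    qed
    show "R (substTy \<sigma> A # \<Delta>) (upS \<sigma>) (A # \<Gamma>)"
      if R: "R \<Delta> \<sigma> \<Gamma>" and A: "isTy \<Delta> (substTy \<sigma> A) l" for \<Delta> \<sigma> \<Gamma> A l
    proof -
      obtain \<rho> where "\<sigma> = TmVar \<circ> \<rho>" "renOK \<Delta> \<rho> \<Gamma>"
        using R by (auto simp: R_def)
      then show ?thesis
        using renOK_liftR[of \<Delta> \<rho> \<Gamma> A l] A
        by (auto simp: R_def upS_TmVar ren_eq_subst)
    qed
  qed
  then show ?thesis
    using assms(2) by (auto simp: R_def ren_eq_subst)
qed

lemma hasTy_weaken:
  assumes "hasTy \<Gamma> t B" and "wfCtx (A # \<Gamma>)" and "wfCtx \<Gamma>"
  shows "hasTy (A # \<Gamma>) (renTm Suc t) (renTy Suc B)"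
  using assms by (auto intro!: hasTy_ren simp: renOK_def)

text \<open>The closure condition that \<open>typing_stable\<close> asks of its class: the new
  variable is typed by \<open>tm_var\<close>, and every older term by
  \<open>hasTy_weaken\<close>.\<close>

lemma substOK_upS:
  assumes "substOK \<Delta> \<sigma> \<Gamma>" and "isTy \<Delta> (substTy \<sigma> A) l"
  shows "substOK (substTy \<sigma> A # \<Delta>) (upS \<sigma>) (A # \<Gamma>)"
proof -
  have wf: "wfCtx (substTy \<sigma> A # \<Delta>)"
    using assms(2) by (rule ctx_ext)
  have "hasTy (substTy \<sigma> A # \<Delta>) (upS \<sigma> i) (substTy (upS \<sigma>) (varTy (A # \<Gamma>) i))"
    if "i < Suc (length \<Gamma>)" for i
  proof (cases i)
    case 0
    then show ?thesis
      using tm_var[OF wf, of 0] by (simp add: substTy_upS_weaken)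
  next
    case (Suc j)
    then show ?thesis
      using assms(1) that wf by (auto simp: substOK_def substTy_upS_weaken intro: hasTy_weaken)
  qed
  with wf show ?thesis by (simp add: substOK_def)
qed

lemma hasTy_subst:
  assumes "hasTy \<Gamma> t A" and "substOK \<Delta> \<sigma> \<Gamma>"
  shows "hasTy \<Delta> (substTm \<sigma> t) (substTy \<sigma> A)"
proof -
  have "head_stable substOK \<Gamma> \<and>
      (\<forall>\<Delta> \<sigma>. substOK \<Delta> \<sigma> \<Gamma> \<longrightarrow> hasTy \<Delta> (substTm \<sigma> t) (substTy \<sigma> A))"
    by (rule typing_stable(3)[OF _ _ _ assms(1)]) (auto intro: substOK_upS, auto simp: substOK_def)
  with assms(2) show ?thesis by blast
qed

section \<open>The forgetful interpretation\<close>

lemma floor_ren: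
  "floorTy (renTy0 \<rho> A) = renTy \<rho> (floorTy A)"
  "floorTm (renTm0 \<rho> t) = renTm \<rho> (floorTm t)"
  by (induction A and t arbitrary: \<rho> and \<rho>) simp_all

lemma floorTm_upS0: "floorTm \<circ> upS0 \<sigma> = upS (floorTm \<circ> \<sigma>)"
  by (simp add: fun_eq_iff upS0_def upS_def floor_ren split: nat.split)

lemma floor_subst:
  "floorTy (substTy0 \<sigma> A) = substTy (floorTm \<circ> \<sigma>) (floorTy A)"
  "floorTm (substTm0 \<sigma> t) = substTm (floorTm \<circ> \<sigma>) (floorTm t)"
  by (induction A and t arbitrary: \<sigma> and \<sigma>) (simp_all add: floorTm_upS0)

lemma floorTm_scons0: "floorTm \<circ> scons0 a = scons (floorTm a)"
  by (simp add: fun_eq_iff scons0_def scons_def split: nat.split)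

lemma floor_inst:
  "floorTy (instTy0 B a) = instTy (floorTy B) (floorTm a)"
  "floorTm (instTm0 t a) = instTm (floorTm t) (floorTm a)"
  by (simp_all add: floor_subst floorTm_scons0)

text \<open>The marker is interpreted by the unit type, and extending by it adds no information.
  Dropping the entry altogether keeps the de Bruijn indices of the two calculi in step.\<close>

definition floorCtx :: "centry list \<Rightarrow> ty list" where
  "floorCtx \<Gamma> = map (floorTy \<circ> snd) (binds \<Gamma>)"

lemma binds_mark [simp]: "binds (mark \<Gamma>) = binds \<Gamma>"
  by (simp add: mark_def)

lemma binds_atMode [simp]: "binds (atMode m \<Gamma>) = binds \<Gamma>"
  by (simp add: atMode_def split: mode.split)

lemma floorCtx_simps [simp]:
  "floorCtx [] = []"
  "floorCtx (Bind m A # \<Gamma>) = floorTy A # floorCtx \<Gamma>"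
  "floorCtx (Mark # \<Gamma>) = floorCtx \<Gamma>"
  "floorCtx (mark \<Gamma>) = floorCtx \<Gamma>"
  "floorCtx (atMode m \<Gamma>) = floorCtx \<Gamma>"
  by (simp_all add: floorCtx_def)

lemma floor_varTy0:
  "i < length (binds \<Gamma>) \<Longrightarrow> floorTy (varTy0 \<Gamma> i) = varTy (floorCtx \<Gamma>) i"
  by (simp add: varTy0_def varTy_def floorCtx_def floor_ren)

text \<open>Once modes are forgotten, \<open>\<Gamma>\<close>, \<open>mark \<Gamma>\<close> and
  \<open>atMode m \<Gamma>\<close> have the same image, so each rule becomes its TT counterpart;
  \<open>ctx0_mark\<close> becomes trivial.\<close>

lemma floor_sound:
  "wfCtx0 \<Gamma> \<Longrightarrow> wfCtx (floorCtx \<Gamma>)"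
  "isTy0 \<Gamma> A l \<Longrightarrow> isTy (floorCtx \<Gamma>) (floorTy A) l"
  "hasTy0 \<Gamma> t A \<Longrightarrow> hasTy (floorCtx \<Gamma>) (floorTm t) (floorTy A)"
  "eqTy0 \<Gamma> A B l \<Longrightarrow> eqTy (floorCtx \<Gamma>) (floorTy A) (floorTy B) l"
  "eqTm0 \<Gamma> t u A \<Longrightarrow> eqTm (floorCtx \<Gamma>) (floorTm t) (floorTm u) (floorTy A)"
proof (induction rule: wfCtx0_isTy0_hasTy0_eqTy0_eqTm0.inducts)
  case (tm0_var \<Gamma> i)
  then show ?case
    \<comment> \<open>The bound on \<open>i\<close> counts entries of \<open>binds \<Gamma>\<close>,
      and \<open>floorCtx \<Gamma>\<close> has the same length.\<close>
    using tm_var[of "floorCtx \<Gamma>" i] by (simp add: floor_varTy0) (simp add: floorCtx_def)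
next
  case ctx0_nil
  then show ?case by - ((simp add: floor_inst floor_ren)?, rule ctx_nil; assumption)
next
  case ctx0_bind
  then show ?case by - ((simp add: floor_inst floor_ren)?, rule ctx_ext; assumption)
next
  case ctx0_mark
  then show ?case by simp
next
  case ty0_U
  then show ?case by - ((simp add: floor_inst floor_ren)?, rule ty_U; assumption)
next
  case ty0_Pi
  then show ?case by - ((simp add: floor_inst floor_ren)?, rule ty_Pi; assumption)
next
  case ty0_Sg
  then show ?case by - ((simp add: floor_inst floor_ren)?, rule ty_Sg; assumption)
next
  case ty0_El
  then show ?case by - ((simp add: floor_inst floor_ren)?, rule ty_El; assumption)
next
  case tm0_lam
  then show ?case by - ((simp add: floor_inst floor_ren)?, rule tm_lam; assumption)
next
  case tm0_app
  then show ?case by - ((simp add: floor_inst floor_ren)?, rule tm_app; assumption)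
next
  case tm0_pair
  then show ?case by - ((simp add: floor_inst floor_ren)?, rule tm_pair; assumption)
next
  case tm0_fst
  then show ?case by - ((simp add: floor_inst floor_ren)?, rule tm_fst; assumption)
next
  case tm0_snd
  then show ?case by - ((simp add: floor_inst floor_ren)?, rule tm_snd; assumption)
next
  case tm0_code
  then show ?case by - ((simp add: floor_inst floor_ren)?, rule tm_code; assumption)
next
  case tm0_conv
  then show ?case by - ((simp add: floor_inst floor_ren)?, rule tm_conv; assumption)
next
  case eqTy0_refl
  then show ?case by - ((simp add: floor_inst floor_ren)?, rule eqTy_refl; assumption)
next
  case eqTy0_sym
  then show ?case by - ((simp add: floor_inst floor_ren)?, rule eqTy_sym; assumption)
next
  case eqTy0_trans
  then show ?case by - ((simp add: floor_inst floor_ren)?, rule eqTy_trans; assumption)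
next
  case eqTy0_Pi
  then show ?case by - ((simp add: floor_inst floor_ren)?, rule eqTy_Pi; assumption)
next
  case eqTy0_Sg
  then show ?case by - ((simp add: floor_inst floor_ren)?, rule eqTy_Sg; assumption)
next
  case eqTy0_El
  then show ?case by - ((simp add: floor_inst floor_ren)?, rule eqTy_El; assumption)
next
  case eqTy0_ElCode
  then show ?case by - ((simp add: floor_inst floor_ren)?, rule eqTy_ElCode; assumption)
next
  case eqTm0_refl
  then show ?case by - ((simp add: floor_inst floor_ren)?, rule eqTm_refl; assumption)
next
  case eqTm0_sym
  then show ?case by - ((simp add: floor_inst floor_ren)?, rule eqTm_sym; assumption)
next
  case eqTm0_trans
  then show ?case by - ((simp add: floor_inst floor_ren)?, rule eqTm_trans; assumption)
next
  case eqTm0_conv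
  then show ?case by - ((simp add: floor_inst floor_ren)?, rule eqTm_conv; assumption)
next
  case eqTm0_lam
  then show ?case by - ((simp add: floor_inst floor_ren)?, rule eqTm_lam; assumption)
next
  case eqTm0_app
  then show ?case by - ((simp add: floor_inst floor_ren)?, rule eqTm_app; assumption)
next
  case eqTm0_pair
  then show ?case by - ((simp add: floor_inst floor_ren)?, rule eqTm_pair; assumption)
next
  case eqTm0_fst
  then show ?case by - ((simp add: floor_inst floor_ren)?, rule eqTm_fst; assumption)
next
  case eqTm0_snd
  then show ?case by - ((simp add: floor_inst floor_ren)?, rule eqTm_snd; assumption)
next
  case eqTm0_code
  then show ?case by - ((simp add: floor_inst floor_ren)?, rule eqTm_code; assumption)
next
  case eqTm0_beta
  then show ?case by - ((simp add: floor_inst floor_ren)?, rule eqTm_beta; assumption)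
next
  case eqTm0_eta
  then show ?case by - ((simp add: floor_inst floor_ren)?, rule eqTm_eta; assumption)
next
  case eqTm0_fst_beta
  then show ?case by - ((simp add: floor_inst floor_ren)?, rule eqTm_fst_beta; assumption)
next
  case eqTm0_snd_beta
  then show ?case by - ((simp add: floor_inst floor_ren)?, rule eqTm_snd_beta; assumption)
next
  case eqTm0_sg_eta
  then show ?case by - ((simp add: floor_inst floor_ren)?, rule eqTm_sg_eta; assumption)
next
  case eqTm0_CodeEl
  then show ?case by - ((simp add: floor_inst floor_ren)?, rule eqTm_CodeEl; assumption)
qed

section \<open>The position of the erasure marker is irrelevant\<close>

text \<open>Types are insensitive to the marker because the only types containing terms are decoded
  in the marked context; terms can only gain from it.\<close>

lemma Mark_in_mark [simp]: "Mark \<in> set (mark \<Gamma>)"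
  by (simp add: mark_def)

lemma mark_eq: "Mark \<in> set \<Gamma> \<Longrightarrow> mark \<Gamma> = \<Gamma>"
  by (simp add: mark_def)

lemma atMode_simps [simp]: "atMode Er \<Gamma> = mark \<Gamma>" "atMode Rt \<Gamma> = \<Gamma>"
  by (simp_all add: atMode_def)

text \<open>The typing, congruence and beta rules of the first projection conclude in
  \<open>atMode m \<Gamma>\<close> rather than \<open>\<Gamma>\<close>. A context
  \<open>\<Gamma>'\<close> comparable to that one must be recognised as
  \<open>atMode m \<Gamma>'\<close> before the rule can be reapplied: in mode \<open>Er\<close> it
  already contains the marker. The other two conclusions feed the induction hypothesis at
  \<open>\<Gamma>\<close>.\<close>

lemma atMode_absorb:
  assumes "binds \<Gamma>' = binds (atMode m \<Gamma>)"
    and "Mark \<in> set (atMode m \<Gamma>) \<longrightarrow> Mark \<in> set \<Gamma>'"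
  shows "atMode m \<Gamma>' = \<Gamma>'" and "binds \<Gamma>' = binds \<Gamma>"
    and "Mark \<in> set \<Gamma> \<longrightarrow> Mark \<in> set \<Gamma>'"
  using assms by (cases m; simp add: mark_eq)+

text \<open>Markers may lie both above and below the topmost binding. The induction peels off those
  above; the second premise holds for every arrangement of those below.\<close>

lemma wfCtx0_binds_Cons:
  assumes "binds \<Gamma>' = (m, A) # \<Delta>" and "\<And>\<Gamma>0. binds \<Gamma>0 = \<Delta> \<Longrightarrow> isTy0 \<Gamma>0 A l"
  shows "wfCtx0 \<Gamma>'"
  using assms(1)
proof (induction \<Gamma>' rule: binds.induct)
  case (2 m' B \<Gamma>)
  then show ?case using assms(2) by (auto intro: ctx0_bind)
next
  case (3 \<Gamma>)
  then show ?case by (auto intro: ctx0_mark)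
qed simp

lemma wfCtx0_binds_Nil: "binds \<Gamma> = [] \<Longrightarrow> wfCtx0 \<Gamma>"
  by (induction \<Gamma> rule: binds.induct) (auto intro: ctx0_nil ctx0_mark)

text \<open>Comparing contexts through \<open>binds\<close> is preserved by a new binding, by
  \<open>mark\<close> and by \<open>atMode\<close>, whereas a plain exchange of two adjacent entries
  is not general enough for the induction. Type judgements impose no condition on the marker because
  \<open>ty0_El\<close> and \<open>eqTy0_El\<close> pass to \<open>mark \<Gamma>\<close>, where both
  contexts contain it.\<close>

lemma marker_irrelevant:
  "wfCtx0 \<Gamma> \<Longrightarrow> binds \<Gamma>' = binds \<Gamma> \<Longrightarrow> wfCtx0 \<Gamma>'"
  "isTy0 \<Gamma> A l \<Longrightarrow> binds \<Gamma>' = binds \<Gamma> \<Longrightarrow> isTy0 \<Gamma>' A l"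
  "hasTy0 \<Gamma> t A \<Longrightarrow> binds \<Gamma>' = binds \<Gamma> \<Longrightarrow> (Mark \<in> set \<Gamma> \<longrightarrow> Mark \<in> set \<Gamma>') \<Longrightarrow>
    hasTy0 \<Gamma>' t A"
  "eqTy0 \<Gamma> A B l \<Longrightarrow> binds \<Gamma>' = binds \<Gamma> \<Longrightarrow> eqTy0 \<Gamma>' A B l"
  "eqTm0 \<Gamma> t u A \<Longrightarrow> binds \<Gamma>' = binds \<Gamma> \<Longrightarrow> (Mark \<in> set \<Gamma> \<longrightarrow> Mark \<in> set \<Gamma>') \<Longrightarrow>
    eqTm0 \<Gamma>' t u A"
proof (induction arbitrary: \<Gamma>' and \<Gamma>' and \<Gamma>' and \<Gamma>' and \<Gamma>'
    rule: wfCtx0_isTy0_hasTy0_eqTy0_eqTm0.inducts)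
  case ctx0_nil
  then show ?case by (simp add: wfCtx0_binds_Nil)
next
  case (ctx0_bind \<Gamma> A l m)
  show ?case
    by (rule wfCtx0_binds_Cons[of _ m A "binds \<Gamma>" l]) (use ctx0_bind in auto)
next
  case (ctx0_mark \<Gamma>)
  then show ?case by simp
next
  case (tm0_var \<Gamma> i)
  \<comment> \<open>Lookup and \<open>varTy0\<close> read only \<open>binds\<close>; the mode
    condition survives since the marker can be gained but not lost.\<close>
  then have "hasTy0 \<Gamma>' (ZVar i) (varTy0 \<Gamma>' i)"
    by (intro wfCtx0_isTy0_hasTy0_eqTy0_eqTm0.tm0_var) auto
  with tm0_var show ?case by (simp add: varTy0_def)
next
  case (tm0_fst \<Gamma> p m A B)
  note ctx = atMode_absorb[OF tm0_fst.prems]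
  have "hasTy0 (atMode m \<Gamma>') (ZFst m p) A"
    by (rule wfCtx0_isTy0_hasTy0_eqTy0_eqTm0.tm0_fst[OF tm0_fst.IH[OF ctx(2,3)]])
  then show ?case by (simp only: ctx(1))
next
  case (eqTm0_fst \<Gamma> p p' m A B)
  note ctx = atMode_absorb[OF eqTm0_fst.prems]
  have "eqTm0 (atMode m \<Gamma>') (ZFst m p) (ZFst m p') A"
    by (rule wfCtx0_isTy0_hasTy0_eqTy0_eqTm0.eqTm0_fst[OF eqTm0_fst.IH[OF ctx(2,3)]])
  then show ?case by (simp only: ctx(1))
next
  case (eqTm0_fst_beta \<Gamma> A l m B a b)
  note ctx = atMode_absorb[OF eqTm0_fst_beta.prems]
  have "eqTm0 (atMode m \<Gamma>') (ZFst m (ZPair m B a b)) a A"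
    by (rule wfCtx0_isTy0_hasTy0_eqTy0_eqTm0.eqTm0_fst_beta;
        (rule eqTm0_fst_beta.IH)?; use ctx(2,3) in \<open>auto simp: atMode_def split: mode.splits\<close>)
  then show ?case by (simp only: ctx(1))
next
  case ty0_U
  \<comment> \<open>The remaining rules conclude in \<open>\<Gamma>\<close> itself and are reapplied
    at \<open>\<Gamma>'\<close>. What is left to check is that the contexts of the premises still
    agree on bindings and keep the marker, by cases on the mode where \<open>atMode\<close>
    occurs.\<close>
  show ?case
    by (rule wfCtx0_isTy0_hasTy0_eqTy0_eqTm0.ty0_U; (rule ty0_U.IH)?;
        use ty0_U.prems in \<open>auto simp: atMode_def split: mode.splits\<close>)
next
  case ty0_Pi
  show ?case
    by (rule wfCtx0_isTy0_hasTy0_eqTy0_eqTm0.ty0_Pi; (rule ty0_Pi.IH)?;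
        use ty0_Pi.prems in \<open>auto simp: atMode_def split: mode.splits\<close>)
next
  case ty0_Sg
  show ?case
    by (rule wfCtx0_isTy0_hasTy0_eqTy0_eqTm0.ty0_Sg; (rule ty0_Sg.IH)?;
        use ty0_Sg.prems in \<open>auto simp: atMode_def split: mode.splits\<close>)
next
  case ty0_El
  show ?case
    by (rule wfCtx0_isTy0_hasTy0_eqTy0_eqTm0.ty0_El; (rule ty0_El.IH)?;
        use ty0_El.prems in \<open>auto simp: atMode_def split: mode.splits\<close>)
next
  case tm0_lam
  show ?case
    by (rule wfCtx0_isTy0_hasTy0_eqTy0_eqTm0.tm0_lam; (rule tm0_lam.IH)?;
        use tm0_lam.prems in \<open>auto simp: atMode_def split: mode.splits\<close>)
next
  case tm0_app
  show ?case
    by (rule wfCtx0_isTy0_hasTy0_eqTy0_eqTm0.tm0_app; (rule tm0_app.IH)?;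
        use tm0_app.prems in \<open>auto simp: atMode_def split: mode.splits\<close>)
next
  case tm0_pair
  show ?case
    by (rule wfCtx0_isTy0_hasTy0_eqTy0_eqTm0.tm0_pair; (rule tm0_pair.IH)?;
        use tm0_pair.prems in \<open>auto simp: atMode_def split: mode.splits\<close>)
next
  case tm0_snd
  show ?case
    by (rule wfCtx0_isTy0_hasTy0_eqTy0_eqTm0.tm0_snd; (rule tm0_snd.IH)?;
        use tm0_snd.prems in \<open>auto simp: atMode_def split: mode.splits\<close>)
next
  case tm0_code
  show ?case
    by (rule wfCtx0_isTy0_hasTy0_eqTy0_eqTm0.tm0_code; (rule tm0_code.IH)?;
        use tm0_code in \<open>auto simp: atMode_def split: mode.splits\<close>)
next
  case tm0_conv
  show ?case
    by (rule wfCtx0_isTy0_hasTy0_eqTy0_eqTm0.tm0_conv; (rule tm0_conv.IH)?;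
        use tm0_conv.prems in \<open>auto simp: atMode_def split: mode.splits\<close>)
next
  case eqTy0_refl
  show ?case
    by (rule wfCtx0_isTy0_hasTy0_eqTy0_eqTm0.eqTy0_refl; (rule eqTy0_refl.IH)?;
        use eqTy0_refl.prems in \<open>auto simp: atMode_def split: mode.splits\<close>)
next
  case eqTy0_sym
  show ?case
    by (rule wfCtx0_isTy0_hasTy0_eqTy0_eqTm0.eqTy0_sym; (rule eqTy0_sym.IH)?;
        use eqTy0_sym.prems in \<open>auto simp: atMode_def split: mode.splits\<close>)
next
  case eqTy0_trans
  show ?case
    by (rule wfCtx0_isTy0_hasTy0_eqTy0_eqTm0.eqTy0_trans; (rule eqTy0_trans.IH)?;
        use eqTy0_trans.prems in \<open>auto simp: atMode_def split: mode.splits\<close>)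
next
  case eqTy0_Pi
  show ?case
    by (rule wfCtx0_isTy0_hasTy0_eqTy0_eqTm0.eqTy0_Pi; (rule eqTy0_Pi.IH)?;
        use eqTy0_Pi.prems in \<open>auto simp: atMode_def split: mode.splits\<close>)
next
  case eqTy0_Sg
  show ?case
    by (rule wfCtx0_isTy0_hasTy0_eqTy0_eqTm0.eqTy0_Sg; (rule eqTy0_Sg.IH)?;
        use eqTy0_Sg.prems in \<open>auto simp: atMode_def split: mode.splits\<close>)
next
  case eqTy0_El
  show ?case
    by (rule wfCtx0_isTy0_hasTy0_eqTy0_eqTm0.eqTy0_El; (rule eqTy0_El.IH)?;
        use eqTy0_El.prems in \<open>auto simp: atMode_def split: mode.splits\<close>)
next
  case eqTy0_ElCode
  show ?case
    by (rule wfCtx0_isTy0_hasTy0_eqTy0_eqTm0.eqTy0_ElCode; (rule eqTy0_ElCode.IH)?;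
        use eqTy0_ElCode.prems in \<open>auto simp: atMode_def split: mode.splits\<close>)
next
  case eqTm0_refl
  show ?case
    by (rule wfCtx0_isTy0_hasTy0_eqTy0_eqTm0.eqTm0_refl; (rule eqTm0_refl.IH)?;
        use eqTm0_refl.prems in \<open>auto simp: atMode_def split: mode.splits\<close>)
next
  case eqTm0_sym
  show ?case
    by (rule wfCtx0_isTy0_hasTy0_eqTy0_eqTm0.eqTm0_sym; (rule eqTm0_sym.IH)?;
        use eqTm0_sym.prems in \<open>auto simp: atMode_def split: mode.splits\<close>)
next
  case eqTm0_trans
  show ?case
    by (rule wfCtx0_isTy0_hasTy0_eqTy0_eqTm0.eqTm0_trans; (rule eqTm0_trans.IH)?;
        use eqTm0_trans.prems in \<open>auto simp: atMode_def split: mode.splits\<close>)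
next
  case eqTm0_conv
  show ?case
    by (rule wfCtx0_isTy0_hasTy0_eqTy0_eqTm0.eqTm0_conv; (rule eqTm0_conv.IH)?;
        use eqTm0_conv.prems in \<open>auto simp: atMode_def split: mode.splits\<close>)
next
  case eqTm0_lam
  show ?case
    by (rule wfCtx0_isTy0_hasTy0_eqTy0_eqTm0.eqTm0_lam; (rule eqTm0_lam.IH)?;
        use eqTm0_lam.prems in \<open>auto simp: atMode_def split: mode.splits\<close>)
next
  case eqTm0_app
  show ?case
    by (rule wfCtx0_isTy0_hasTy0_eqTy0_eqTm0.eqTm0_app; (rule eqTm0_app.IH)?;
        use eqTm0_app.prems in \<open>auto simp: atMode_def split: mode.splits\<close>)
next
  case eqTm0_pair
  show ?case
    by (rule wfCtx0_isTy0_hasTy0_eqTy0_eqTm0.eqTm0_pair; (rule eqTm0_pair.IH)?;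
        use eqTm0_pair.prems in \<open>auto simp: atMode_def split: mode.splits\<close>)
next
  case eqTm0_snd
  show ?case
    by (rule wfCtx0_isTy0_hasTy0_eqTy0_eqTm0.eqTm0_snd; (rule eqTm0_snd.IH)?;
        use eqTm0_snd.prems in \<open>auto simp: atMode_def split: mode.splits\<close>)
next
  case eqTm0_code
  show ?case
    by (rule wfCtx0_isTy0_hasTy0_eqTy0_eqTm0.eqTm0_code; (rule eqTm0_code.IH)?;
        use eqTm0_code in \<open>auto simp: atMode_def split: mode.splits\<close>)
next
  case eqTm0_beta
  show ?case
    by (rule wfCtx0_isTy0_hasTy0_eqTy0_eqTm0.eqTm0_beta; (rule eqTm0_beta.IH)?;
        use eqTm0_beta.prems in \<open>auto simp: atMode_def split: mode.splits\<close>)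
next
  case eqTm0_eta
  show ?case
    by (rule wfCtx0_isTy0_hasTy0_eqTy0_eqTm0.eqTm0_eta; (rule eqTm0_eta.IH)?;
        use eqTm0_eta.prems in \<open>auto simp: atMode_def split: mode.splits\<close>)
next
  case eqTm0_snd_beta
  show ?case
    by (rule wfCtx0_isTy0_hasTy0_eqTy0_eqTm0.eqTm0_snd_beta; (rule eqTm0_snd_beta.IH)?;
        use eqTm0_snd_beta.prems in \<open>auto simp: atMode_def split: mode.splits\<close>)
next
  case eqTm0_sg_eta
  show ?case
    by (rule wfCtx0_isTy0_hasTy0_eqTy0_eqTm0.eqTm0_sg_eta; (rule eqTm0_sg_eta.IH)?;
        use eqTm0_sg_eta.prems in \<open>auto simp: atMode_def split: mode.splits\<close>)
next
  case eqTm0_CodeEl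
  show ?case
    by (rule wfCtx0_isTy0_hasTy0_eqTy0_eqTm0.eqTm0_CodeEl; (rule eqTm0_CodeEl.IH)?;
        use eqTm0_CodeEl in \<open>auto simp: atMode_def split: mode.splits\<close>)
qed

section \<open>The erased interpretation\<close>

lemma ang_ren:
  "angTy (renTy \<rho> A) = renTy0 \<rho> (angTy A)"
  "angTm (renTm \<rho> t) = renTm0 \<rho> (angTm t)"
  by (induction A and t arbitrary: \<rho> and \<rho>) simp_all

lemma angTm_upS: "angTm \<circ> upS \<sigma> = upS0 (angTm \<circ> \<sigma>)"
  by (simp add: fun_eq_iff upS0_def upS_def ang_ren split: nat.split)

lemma ang_subst:
  "angTy (substTy \<sigma> A) = substTy0 (angTm \<circ> \<sigma>) (angTy A)"
  "angTm (substTm \<sigma> t) = substTm0 (angTm \<circ> \<sigma>) (angTm t)"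
  by (induction A and t arbitrary: \<sigma> and \<sigma>) (simp_all add: angTm_upS)

lemma angTm_scons: "angTm \<circ> scons a = scons0 (angTm a)"
  by (simp add: fun_eq_iff scons0_def scons_def split: nat.split)

lemma ang_inst:
  "angTy (instTy B a) = instTy0 (angTy B) (angTm a)"
  "angTm (instTm t a) = instTm0 (angTm t) (angTm a)"
  by (simp_all add: ang_subst angTm_scons)

lemma floor_ang [simp]: "floorTy (angTy A) = A" "floorTm (angTm t) = t"
  by (induction A and t) simp_all

lemma binds_angCtx: "binds (angCtx \<Gamma>) = map (\<lambda>A. (Er, angTy A)) \<Gamma>"
  by (induction \<Gamma>) (simp_all add: angCtx_def)

lemma floorCtx_angCtx [simp]: "floorCtx (angCtx \<Gamma>) = \<Gamma>"
  by (simp add: floorCtx_def binds_angCtx comp_def)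

lemma angCtx_simps [simp]:
  "angCtx [] = []" "angCtx (A # \<Gamma>) = Bind Er (angTy A) # angCtx \<Gamma>"
  by (simp_all add: angCtx_def)

lemma mark_angCtx: "mark (angCtx \<Gamma>) = Mark # angCtx \<Gamma>"
  by (auto simp: mark_def angCtx_def)

lemma mark_Cons_Mark [simp]: "mark (Mark # \<Gamma>) = Mark # \<Gamma>"
  by (simp add: mark_def)

text \<open>Both contexts have the same \<open>binds\<close> and both contain the marker, which is
  all that \<open>marker_irrelevant\<close> asks for.\<close>

lemma swap_Mark:
  "isTy0 (Mark # Bind m A # \<Gamma>) B l \<Longrightarrow> isTy0 (Bind m A # Mark # \<Gamma>) B l"
  "hasTy0 (Mark # Bind m A # \<Gamma>) t B \<Longrightarrow> hasTy0 (Bind m A # Mark # \<Gamma>) t B"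
  "eqTy0 (Mark # Bind m A # \<Gamma>) B B' l \<Longrightarrow> eqTy0 (Bind m A # Mark # \<Gamma>) B B' l"
  "eqTm0 (Mark # Bind m A # \<Gamma>) t u B \<Longrightarrow> eqTm0 (Bind m A # Mark # \<Gamma>) t u B"
  by (erule marker_irrelevant; simp)+

text \<open>Every binding of \<open>angCtx \<Gamma>\<close> is erased, so its variables and all
  codes are usable only with the marker present; hence the marked context even for the formation
  judgements.\<close>

lemma ang_sound:
  "wfCtx \<Gamma> \<Longrightarrow> wfCtx0 (Mark # angCtx \<Gamma>)"
  "isTy \<Gamma> A l \<Longrightarrow> isTy0 (Mark # angCtx \<Gamma>) (angTy A) l"
  "hasTy \<Gamma> t A \<Longrightarrow> hasTy0 (Mark # angCtx \<Gamma>) (angTm t) (angTy A)"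
  "eqTy \<Gamma> A B l \<Longrightarrow> eqTy0 (Mark # angCtx \<Gamma>) (angTy A) (angTy B) l"
  "eqTm \<Gamma> t u A \<Longrightarrow> eqTm0 (Mark # angCtx \<Gamma>) (angTm t) (angTm u) (angTy A)"
proof (induction rule: wfCtx_isTy_hasTy_eqTy_eqTm.inducts)
  case ctx_nil
  then show ?case by (auto intro: ctx0_nil ctx0_mark)
next
  case (ctx_ext \<Gamma> A l)
  \<comment> \<open>The new binding goes below the marker, so its type is needed in the unmarked
    context; a type judgement may lose the marker.\<close>
  then have "isTy0 (angCtx \<Gamma>) (angTy A) l" by (auto elim: marker_irrelevant)
  then show ?case by (auto intro: ctx0_bind ctx0_mark)
next
  case (tm_var \<Gamma> i)
  then have "hasTy0 (Mark # angCtx \<Gamma>) (ZVar i) (varTy0 (Mark # angCtx \<Gamma>) i)"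
    by (intro tm0_var) (simp_all add: binds_angCtx)
  with tm_var show ?case by (simp add: varTy0_def varTy_def binds_angCtx ang_ren)
next
  case (tm_fst \<Gamma> p A B)
  \<comment> \<open>In a context that already contains the marker, \<open>atMode Er\<close> is the
    identity, so the projection stays in the same context.\<close>
  then show ?case using tm0_fst[of "Mark # angCtx \<Gamma>" _ Er] by simp
next
  case (eqTm_fst \<Gamma> p p' A B)
  then show ?case using eqTm0_fst[of "Mark # angCtx \<Gamma>" _ _ Er] by simp
next
  case (eqTm_fst_beta \<Gamma> A l B a b)
  then show ?case
    using eqTm0_fst_beta[of "Mark # angCtx \<Gamma>" _ l Er] by (simp add: swap_Mark ang_inst)
next
  case (eqTm_eta \<Gamma> f A B)
  then show ?case by (simp add: ang_ren eqTm0_eta)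
next
  case ty_U
  then show ?case
    by - ((simp add: ang_inst)?, rule ty0_U; (rule swap_Mark)?; (assumption | simp))
next
  case ty_Pi
  then show ?case
    by - ((simp add: ang_inst)?, rule ty0_Pi; (rule swap_Mark)?; (assumption | simp))
next
  case ty_Sg
  then show ?case
    by - ((simp add: ang_inst)?, rule ty0_Sg; (rule swap_Mark)?; (assumption | simp))
next
  case ty_El
  then show ?case
    by - ((simp add: ang_inst)?, rule ty0_El; (rule swap_Mark)?; (assumption | simp))
next
  case tm_lam
  then show ?case
    by - ((simp add: ang_inst)?, rule tm0_lam; (rule swap_Mark)?; (assumption | simp))
next
  case tm_app
  then show ?case
    by - ((simp add: ang_inst)?, rule tm0_app; (rule swap_Mark)?; (assumption | simp))
next
  case tm_pair
  then show ?case
    by - ((simp add: ang_inst)?, rule tm0_pair; (rule swap_Mark)?; (assumption | simp))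
next
  case tm_snd
  then show ?case
    by - ((simp add: ang_inst)?, rule tm0_snd; (rule swap_Mark)?; (assumption | simp))
next
  case tm_code
  then show ?case
    by - ((simp add: ang_inst)?, rule tm0_code; (rule swap_Mark)?; (assumption | simp))
next
  case tm_conv
  then show ?case
    by - ((simp add: ang_inst)?, rule tm0_conv; (rule swap_Mark)?; (assumption | simp))
next
  case eqTy_refl
  then show ?case
    by - ((simp add: ang_inst)?, rule eqTy0_refl; (rule swap_Mark)?; (assumption | simp))
next
  case eqTy_sym
  then show ?case
    by - ((simp add: ang_inst)?, rule eqTy0_sym; (rule swap_Mark)?; (assumption | simp))
next
  case eqTy_trans
  then show ?case
    by - ((simp add: ang_inst)?, rule eqTy0_trans; (rule swap_Mark)?; (assumption | simp))
next
  case eqTy_Pi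
  then show ?case
    by - ((simp add: ang_inst)?, rule eqTy0_Pi; (rule swap_Mark)?; (assumption | simp))
next
  case eqTy_Sg
  then show ?case
    by - ((simp add: ang_inst)?, rule eqTy0_Sg; (rule swap_Mark)?; (assumption | simp))
next
  case eqTy_El
  then show ?case
    by - ((simp add: ang_inst)?, rule eqTy0_El; (rule swap_Mark)?; (assumption | simp))
next
  case eqTy_ElCode
  then show ?case
    by - ((simp add: ang_inst)?, rule eqTy0_ElCode; (rule swap_Mark)?; (assumption | simp))
next
  case eqTm_refl
  then show ?case
    by - ((simp add: ang_inst)?, rule eqTm0_refl; (rule swap_Mark)?; (assumption | simp))
next
  case eqTm_sym
  then show ?case
    by - ((simp add: ang_inst)?, rule eqTm0_sym; (rule swap_Mark)?; (assumption | simp))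
next
  case eqTm_trans
  then show ?case
    by - ((simp add: ang_inst)?, rule eqTm0_trans; (rule swap_Mark)?; (assumption | simp))
next
  case eqTm_conv
  then show ?case
    by - ((simp add: ang_inst)?, rule eqTm0_conv; (rule swap_Mark)?; (assumption | simp))
next
  case eqTm_lam
  then show ?case
    by - ((simp add: ang_inst)?, rule eqTm0_lam; (rule swap_Mark)?; (assumption | simp))
next
  case eqTm_app
  then show ?case
    by - ((simp add: ang_inst)?, rule eqTm0_app; (rule swap_Mark)?; (assumption | simp))
next
  case eqTm_pair
  then show ?case
    by - ((simp add: ang_inst)?, rule eqTm0_pair; (rule swap_Mark)?; (assumption | simp))
next
  case eqTm_snd
  then show ?case
    by - ((simp add: ang_inst)?, rule eqTm0_snd; (rule swap_Mark)?; (assumption | simp))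
next
  case eqTm_code
  then show ?case
    by - ((simp add: ang_inst)?, rule eqTm0_code; (rule swap_Mark)?; (assumption | simp))
next
  case eqTm_beta
  then show ?case
    by - ((simp add: ang_inst)?, rule eqTm0_beta; (rule swap_Mark)?; (assumption | simp))
next
  case eqTm_snd_beta
  then show ?case
    by - ((simp add: ang_inst)?, rule eqTm0_snd_beta; (rule swap_Mark)?; (assumption | simp))
next
  case eqTm_sg_eta
  then show ?case
    by - ((simp add: ang_inst)?, rule eqTm0_sg_eta; (rule swap_Mark)?; (assumption | simp))
next
  case eqTm_CodeEl
  then show ?case
    by - ((simp add: ang_inst)?, rule eqTm0_CodeEl; (rule swap_Mark)?; (assumption | simp))
qed

section \<open>The induced map on terms: well-definedness, naturality and surjectivity\<close>

theorem mainTheorem2: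
  assumes "wfCtx \<Gamma>" and "isTy \<Gamma> A l"
  shows
    \<comment> \<open>floor sends Tm_0 <Gamma> <A> into Tm Gamma A ...\<close>
    "(\<forall>t. hasTy0E (angCtx \<Gamma>) t (angTy A) \<longrightarrow> hasTy \<Gamma> (floorTm t) A)
     \<comment> \<open>... respecting definitional equality, so it induces a map on the quotients,\<close>
   \<and> (\<forall>t u. eqTm0E (angCtx \<Gamma>) t u (angTy A) \<longrightarrow> eqTm \<Gamma> (floorTm t) (floorTm u) A)
     \<comment> \<open>which is natural in Gamma (commutes with substitution along any sigma : Delta -> Gamma),\<close>
   \<and> (\<forall>\<Delta> \<sigma> t. substOK \<Delta> \<sigma> \<Gamma> \<longrightarrow> hasTy0E (angCtx \<Gamma>) t (angTy A) \<longrightarrow>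
        eqTm \<Delta> (floorTm (substTm0 (angTm \<circ> \<sigma>) t)) (substTm \<sigma> (floorTm t)) (substTy \<sigma> A))
     \<comment> \<open>and surjective.\<close>
   \<and> (\<forall>u. hasTy \<Gamma> u A \<longrightarrow>
        (\<exists>t. hasTy0E (angCtx \<Gamma>) t (angTy A) \<and> eqTm \<Gamma> (floorTm t) u A))"
proof (intro conjI allI impI)
  show "hasTy \<Gamma> (floorTm t) A" if "hasTy0E (angCtx \<Gamma>) t (angTy A)" for t
    \<comment> \<open>Soundness is used at \<open>mark (angCtx \<Gamma>)\<close>, whose floor is
      \<open>\<Gamma>\<close> again, and \<open>floorTy (angTy A)\<close> collapses to
      \<open>A\<close>.\<close>
    using floor_sound(3) that unfolding hasTy0E_def by fastforce
  show "eqTm \<Gamma> (floorTm t) (floorTm u) A" if "eqTm0E (angCtx \<Gamma>) t u (angTy A)" for t u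
    using floor_sound(5) that unfolding eqTm0E_def by fastforce
  show "eqTm \<Delta> (floorTm (substTm0 (angTm \<circ> \<sigma>) t)) (substTm \<sigma> (floorTm t)) (substTy \<sigma> A)"
    if \<sigma>: "substOK \<Delta> \<sigma> \<Gamma>" and t: "hasTy0E (angCtx \<Gamma>) t (angTy A)" for \<Delta> \<sigma> t
  proof -
    have "hasTy \<Gamma> (floorTm t) A"
      using floor_sound(3) t unfolding hasTy0E_def by fastforce
    then have "hasTy \<Delta> (substTm \<sigma> (floorTm t)) (substTy \<sigma> A)"
      using \<sigma> by (rule hasTy_subst)
    \<comment> \<open>Composing \<open>floorTm\<close> with \<open>angTm\<close> and
      \<open>\<sigma>\<close> gives back \<open>\<sigma>\<close>, so the two sides are one raw term
      and reflexivity suffices.\<close>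
    then show ?thesis by (simp add: floor_subst comp_def eqTm_refl)
  qed
  show "\<exists>t. hasTy0E (angCtx \<Gamma>) t (angTy A) \<and> eqTm \<Gamma> (floorTm t) u A" if u: "hasTy \<Gamma> u A" for u
  proof (intro exI conjI)
    show "hasTy0E (angCtx \<Gamma>) (angTm u) (angTy A)"
      using ang_sound(3)[OF u] by (simp add: hasTy0E_def mark_angCtx)
    show "eqTm \<Gamma> (floorTm (angTm u)) u A"
      using u by (simp add: eqTm_refl)
  qed
qed

end
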